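(* Let $n,m\in\mathbb{N}_0$ be such that $m\leq\lfloor n/2\rfloor$. Then $$\sum_{i=m}^{\lfloor n/2\rfloor}\frac{(-1)^i}{4^i}\binom{i}{m}\binom{n-i}{i}=\frac{(-1)^m}{2^n}\binom{n+1}{2m+1}.$$
   Context: $\mathbb{N}_0=\{0,1,2,\dots\}$, $\lfloor\cdot\rfloor$ is the floor function, and $\binom{a}{b}$ denotes the usual binomial coefficient. The identity is between rational (real) numbers. *)

theory Defs
  imports Complex_Main
begin

end

theory Submission
  imports Defs
begin

text \<open>
  Sums \<open>\<Sum>i. f i * (n - i choose i)\<close> along the shallow diagonals of Pascal's triangle obey a
  weighted Fibonacci recurrence in \<open>n\<close> (lemma \<open>diagonal_sum_rec\<close>): Pascal's rule splits each entry
  into one on each of the two preceding diagonals, and the weight is shifted by one on the second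
  of them. For the weight \<open>(-1/4) ^ i * (i choose m)\<close> the shifted weight is, again by Pascal's
  rule, \<open>-1/4\<close> times the sum of the weights for \<open>m\<close> and \<open>m - 1\<close>. Hence the left-hand side
  \<open>S n m\<close> satisfies \<open>S (n + 2) m = S (n + 1) m - (S n m + S n (m - 1)) / 4\<close>, with the last
  summand absent for \<open>m = 0\<close>. The right-hand side satisfies the same recurrence, which is Pascal's
  rule applied twice to \<open>n + 3 choose 2 * m + 1\<close>, and both sides agree for \<open>n = 0\<close> and \<open>n = 1\<close>.
\<close>

lemma diagonal_sum_rec:
  fixes f :: "nat \<Rightarrow> real"
  shows "(\<Sum>i\<le>n + 2. f i * real ((n + 2 - i) choose i))
    = (\<Sum>i\<le>n + 1. f i * real ((n + 1 - i) choose i)) + (\<Sum>i\<le>n. f (Suc i) * real ((n - i) choose i))"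
proof -
  have "(\<Sum>i\<le>n + 2. f i * real ((n + 2 - i) choose i))
      = f 0 + (\<Sum>i\<le>Suc n. f (Suc i) * real ((Suc n - i) choose Suc i))"
    by (simp add: sum.atMost_Suc_shift del: sum.atMost_Suc)
  also have "(\<Sum>i\<le>Suc n. f (Suc i) * real ((Suc n - i) choose Suc i))
      = (\<Sum>i\<le>n. f (Suc i) * real ((Suc n - i) choose Suc i))"
    by simp
  also have "\<dots> = (\<Sum>i\<le>n. f (Suc i) * real ((n - i) choose Suc i))
      + (\<Sum>i\<le>n. f (Suc i) * real ((n - i) choose i))"
    by (simp add: sum.distrib [symmetric] Suc_diff_le algebra_simps)
  also have "f 0 + \<dots> = (\<Sum>i\<le>n + 1. f i * real ((n + 1 - i) choose i))
      + (\<Sum>i\<le>n. f (Suc i) * real ((n - i) choose i))"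
    by (simp add: sum.atMost_Suc_shift del: sum.atMost_Suc)
  finally show ?thesis .
qed

text \<open>
  Summing over all \<open>i \<le> n\<close> adds only vanishing terms and frees the range from \<open>m\<close> and from the
  parity of \<open>n\<close>; the identity then holds for every \<open>m\<close>, which the induction on \<open>n\<close> relies on
  because the bound \<open>m \<le> n div 2\<close> does not pass to smaller \<open>n\<close>.
\<close>

lemma alternating_diagonal_sum:
  "(\<Sum>i\<le>n. (- 1 / 4) ^ i * real (i choose m) * real ((n - i) choose i))
    = (- 1) ^ m / 2 ^ n * real ((n + 1) choose (2 * m + 1))"
proof (induction n arbitrary: m rule: induct_nat_012)
  case 0
  show ?case by (cases m) simp_all
next
  case 1
  show ?case by (cases m) (simp_all add: numeral_2_eq_2)
next
  case (ge2 n)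
  let ?S = "\<lambda>n m. \<Sum>i\<le>n. (- 1 / 4) ^ i * real (i choose m) * real ((n - i) choose i)"
  have rec: "?S (Suc (Suc n)) m = ?S (Suc n) m
      + (\<Sum>i\<le>n. (- 1 / 4) ^ Suc i * real (Suc i choose m) * real ((n - i) choose i))"
    using diagonal_sum_rec [of "\<lambda>i. (- 1 / 4) ^ i * real (i choose m)" n]
    by (simp only: add_2_eq_Suc' Suc_eq_plus1 [symmetric])
  show ?case
  proof (cases m)
    case 0
    have "?S (Suc (Suc n)) m = ?S (Suc n) m - ?S n m / 4"
      unfolding rec using 0 by (simp add: sum_divide_distrib sum_negf)
    then show ?thesis
      using 0 by (simp only: ge2.IH) (simp add: field_simps)
  next
    case (Suc k)
    have "(\<Sum>i\<le>n. (- 1 / 4) ^ Suc i * real (Suc i choose m) * real ((n - i) choose i))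
        = (\<Sum>i\<le>n. (- 1 / 4) * ((- 1 / 4) ^ i * real (i choose m) * real ((n - i) choose i)
            + (- 1 / 4) ^ i * real (i choose k) * real ((n - i) choose i)))"
      using Suc by (intro sum.cong) (simp_all add: algebra_simps)
    also have "\<dots> = - (?S n m + ?S n k) / 4"
      by (simp only: sum_distrib_left [symmetric] sum.distrib)
    finally have "?S (Suc (Suc n)) m = ?S (Suc n) m - (?S n m + ?S n k) / 4"
      unfolding rec by linarith
    then show ?thesis
      using Suc by (simp only: ge2.IH) (simp add: field_simps)
  qed
qed

theorem proposition2p1:
  fixes n m :: nat
  assumes "m \<le> n div 2"
  shows "(\<Sum>i = m..n div 2. (- 1) ^ i / 4 ^ i * real (i choose m) * real ((n - i) choose i))
    = (- 1) ^ m / 2 ^ n * real ((n + 1) choose (2 * m + 1))"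
proof -
  have "(\<Sum>i = m..n div 2. (- 1) ^ i / 4 ^ i * real (i choose m) * real ((n - i) choose i))
      = (\<Sum>i\<le>n. (- 1 / 4) ^ i * real (i choose m) * real ((n - i) choose i))"
  proof (rule sum.mono_neutral_cong_left)
    show "\<forall>i\<in>{..n} - {m..n div 2}.
        (- 1 / 4) ^ i * real (i choose m) * real ((n - i) choose i) = 0"
    proof
      fix i assume "i \<in> {..n} - {m..n div 2}"
      then have "i < m \<or> n - i < i" by auto
      then show "(- 1 / 4) ^ i * real (i choose m) * real ((n - i) choose i) = 0"
        by (auto simp: binomial_eq_0)
    qed
  qed (auto simp: power_divide [symmetric])
  then show ?thesis
    by (simp only: alternating_diagonal_sum)
qed

end
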